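(* Let $L$ be a primitive Gaussian line, with associated Gaussian integers $\alpha_0=a+bi$ and $\delta=c+di$, and suppose $\Delta=ad-bc\neq 0$. A Gaussian integer $\beta$ is in the divisor set $\mathcal{D}(L)$ of $L$ if and only if $\beta$ can be written as $$\beta=\mu\, r\,(1+i)^t\,\pi_1^{k_1}\pi_2^{k_2}\cdots\pi_m^{k_m},$$ where: (a) $\mu\in\{\pm1,\pm i\}$ is a unit in $\mathbb{Z}[i]$; (b) $r$ is a rational integer that divides $\Delta$; (c) $t=0$ if $1+i$ divides $\delta$, and $t\in\{0,1\}$ otherwise; (d) for $1\le j\le m$, $\pi_j$ is a Gaussian prime such that $\pi_j$ does not divide $\delta$, $N(\pi_j)\neq 2$, and $N(\pi_j)\neq N(\pi_n)$ for $j\neq n$; (e) for $1\le j\le m$, $k_j\ge 0$ is a rational integer.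
   Context: A Gaussian line is a line in the complex plane containing at least two (hence infinitely many) elements of $\mathbb{Z}[i]$. It is primitive if the Gaussian integers on it do not all share a common non-unit divisor in $\mathbb{Z}[i]$. For a Gaussian line $L$, $\alpha_0=a+bi$ denotes the Gaussian integer on $L$ of minimum norm $N(x+iy)=x^2+y^2$ (if there are two, the one with larger real part). If $L$ is vertical, $\delta=c+di=i$; otherwise $\delta=c+di=\alpha_1-\alpha_0$, where $\alpha_1$ is the Gaussian integer on $L$ closest to $\alpha_0$ with $\mathrm{Re}(\alpha_1)>\mathrm{Re}(\alpha_0)$. Here $a,b,c,d\in\mathbb{Z}$. Then the Gaussian integers on $L$ are exactly $\alpha_n=\alpha_0+\delta n$, $n\in\mathbb{Z}$. The divisor set of $L$ is $\mathcal{D}(L)=\{\beta\in\mathbb{Z}[i]:\beta\mid\alpha_n\text{ for some }n\in\mathbb{Z}\}$. Rational integers are the elements of $\mathbb{Z}$. A Gaussian prime is a prime element of $\mathbb{Z}[i]$.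
   Formalization: Condition (d) additionally requires that π_j is not an associate of a rational integer; without this the claim is false, e.g. for the line Re z = 1 (Δ = 1, δ = i) and β = π_1 = 3, which divides no 1 + ni. *)

theory Defs
  imports "HOL-Analysis.Analysis" "HOL-Computational_Algebra.Computational_Algebra"
begin

section \<open>The ring of Gaussian integers\<close>

datatype gauss_int = Gauss (gre: int) (gim: int)

instantiation gauss_int :: idom
begin

definition zero_gauss_int :: gauss_int where "0 = Gauss 0 0"
definition one_gauss_int :: gauss_int where "1 = Gauss 1 0"
definition uminus_gauss_int :: "gauss_int \<Rightarrow> gauss_int"
  where "- x = Gauss (- gre x) (- gim x)"
definition plus_gauss_int :: "gauss_int \<Rightarrow> gauss_int \<Rightarrow> gauss_int"
  where "x + y = Gauss (gre x + gre y) (gim x + gim y)"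
definition minus_gauss_int :: "gauss_int \<Rightarrow> gauss_int \<Rightarrow> gauss_int"
  where "x - y = Gauss (gre x - gre y) (gim x - gim y)"
definition times_gauss_int :: "gauss_int \<Rightarrow> gauss_int \<Rightarrow> gauss_int"
  where "x * y = Gauss (gre x * gre y - gim x * gim y) (gre x * gim y + gim x * gre y)"

instance
proof
  fix x y :: gauss_int
  assume "x \<noteq> 0" "y \<noteq> 0"
  obtain a b c d where xy: "x = Gauss a b" "y = Gauss c d"
    by (meson gauss_int.exhaust)
  have nz: "a\<^sup>2 + b\<^sup>2 \<noteq> 0" "c\<^sup>2 + d\<^sup>2 \<noteq> 0"
    using \<open>x \<noteq> 0\<close> \<open>y \<noteq> 0\<close> xy by (auto simp: zero_gauss_int_def sum_power2_eq_zero_iff)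
  have "(a\<^sup>2 + b\<^sup>2) * (c\<^sup>2 + d\<^sup>2) = (a * c - b * d)\<^sup>2 + (a * d + b * c)\<^sup>2"
    by (simp add: power2_eq_square algebra_simps)
  with nz have "(a * c - b * d)\<^sup>2 + (a * d + b * c)\<^sup>2 \<noteq> 0"
    by (metis mult_eq_0_iff)
  then show "x * y \<noteq> 0"
    by (auto simp: xy times_gauss_int_def zero_gauss_int_def)
qed (auto simp: zero_gauss_int_def one_gauss_int_def uminus_gauss_int_def plus_gauss_int_def
        minus_gauss_int_def times_gauss_int_def algebra_simps intro: gauss_int.expand)

end

abbreviation gauss_i :: gauss_int ("\<i>\<^sub>G")
  where "\<i>\<^sub>G \<equiv> Gauss 0 1"

definition gnorm :: "gauss_int \<Rightarrow> int"
  where "gnorm x = (gre x)\<^sup>2 + (gim x)\<^sup>2"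

definition of_gauss :: "gauss_int \<Rightarrow> complex"
  where "of_gauss x = Complex (of_int (gre x)) (of_int (gim x))"

(* No associate is a rational integer.  For a Gaussian prime this excludes exactly the inert rational
   primes q = 3 (mod 4) and their associates.  In the factorisation of the members of a divisor set
   these primes have to be part of the rational factor r, which divides a d - b c: if q divides a
   point x + y i of the line then q divides x d - y c = a d - b c.  On the line Re z = 1, for
   instance, a d - b c = 1 and delta = i; the Gaussian prime 3 does not divide delta and has
   norm 9, but it divides no point 1 + n i. *)
definition non_rational :: "gauss_int \<Rightarrow> bool"
  where "non_rational x \<longleftrightarrow> \<not> (\<exists>q :: int. x dvd of_int q \<and> of_int q dvd x)"


section \<open>Gaussian lines\<close>

definition gaussian_line :: "complex set \<Rightarrow> bool"
  where "gaussian_line L \<longleftrightarrow> affine L \<and> aff_dim L = 1 \<and>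
           (\<exists>z w. z \<noteq> w \<and> of_gauss z \<in> L \<and> of_gauss w \<in> L)"

definition primitive_line :: "complex set \<Rightarrow> bool"
  where "primitive_line L \<longleftrightarrow>
           \<not> (\<exists>\<gamma>. \<not> \<gamma> dvd 1 \<and> (\<forall>\<alpha>. of_gauss \<alpha> \<in> L \<longrightarrow> \<gamma> dvd \<alpha>))"

definition vertical :: "complex set \<Rightarrow> bool"
  where "vertical L \<longleftrightarrow> (\<forall>z\<in>L. \<forall>w\<in>L. Re z = Re w)"

definition is_alpha0 :: "complex set \<Rightarrow> gauss_int \<Rightarrow> bool"
  where "is_alpha0 L \<alpha> \<longleftrightarrow> of_gauss \<alpha> \<in> L \<and>
           (\<forall>\<beta>. of_gauss \<beta> \<in> L \<longrightarrow>
              gnorm \<alpha> < gnorm \<beta> \<or> (gnorm \<alpha> = gnorm \<beta> \<and> gre \<beta> \<le> gre \<alpha>))"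

definition alpha0 :: "complex set \<Rightarrow> gauss_int"
  where "alpha0 L = (THE \<alpha>. is_alpha0 L \<alpha>)"

definition is_alpha1 :: "complex set \<Rightarrow> gauss_int \<Rightarrow> bool"
  where "is_alpha1 L \<alpha> \<longleftrightarrow> of_gauss \<alpha> \<in> L \<and> gre (alpha0 L) < gre \<alpha> \<and>
           (\<forall>\<beta>. of_gauss \<beta> \<in> L \<and> gre (alpha0 L) < gre \<beta> \<longrightarrow>
              dist (of_gauss \<alpha>) (of_gauss (alpha0 L)) \<le> dist (of_gauss \<beta>) (of_gauss (alpha0 L)))"

definition delta :: "complex set \<Rightarrow> gauss_int"
  where "delta L = (if vertical L then \<i>\<^sub>G else (THE \<alpha>. is_alpha1 L \<alpha>) - alpha0 L)"

definition line_point :: "complex set \<Rightarrow> int \<Rightarrow> gauss_int"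
  where "line_point L n = alpha0 L + delta L * of_int n"

definition divisor_set :: "complex set \<Rightarrow> gauss_int set"
  where "divisor_set L = {\<beta>. \<exists>n. \<beta> dvd line_point L n}"


section \<open>The distinguished points exist and are unique\<close>

lemma gre_gim_simps [simp]:
  "gre (x + y) = gre x + gre y" "gim (x + y) = gim x + gim y"
  "gre (x - y) = gre x - gre y" "gim (x - y) = gim x - gim y"
  by (simp_all add: plus_gauss_int_def minus_gauss_int_def)

lemma of_gauss_add: "of_gauss (x + y) = of_gauss x + of_gauss y"
  and of_gauss_diff: "of_gauss (x - y) = of_gauss x - of_gauss y"
  by (simp_all add: of_gauss_def complex_eq_iff)

lemma of_gauss_inj: "of_gauss x = of_gauss y \<longleftrightarrow> x = y"
  by (auto simp: of_gauss_def complex_eq_iff intro: gauss_int.expand)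

lemma dist_of_gauss: "dist (of_gauss x) (of_gauss y) = sqrt (of_int (gnorm (x - y)))"
  by (simp add: dist_norm flip: of_gauss_diff) (simp add: of_gauss_def gnorm_def cmod_def)

lemma gnorm_nonneg: "0 \<le> gnorm x"
  by (simp add: gnorm_def)

lemma line_param:
  assumes L: "gaussian_line L" and "z \<in> L" "w \<in> L" "z \<noteq> w" "u \<in> L"
  obtains t :: real where "u = z + of_real t * (w - z)"
proof -
  have "affine hull {z, w} = L"
  proof (rule affine_dim_equal)
    show "affine hull {z, w} \<subseteq> L"
      using L assms by (intro hull_minimal) (auto simp: gaussian_line_def)
    show "aff_dim (affine hull {z, w}) = aff_dim L"
      using L assms by (simp add: gaussian_line_def aff_dim_2)
  qed (use L in \<open>auto simp: gaussian_line_def\<close>)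
  with \<open>u \<in> L\<close> obtain p q where "u = p *\<^sub>R z + q *\<^sub>R w" "p + q = 1"
    by (auto simp: affine_hull_2)
  have "p = 1 - q"
    using \<open>p + q = 1\<close> by simp
  have "u = z + of_real q * (w - z)"
    unfolding \<open>u = p *\<^sub>R z + q *\<^sub>R w\<close> \<open>p = 1 - q\<close> by (simp add: scaleR_conv_of_real algebra_simps)
  then show ?thesis using that by blast
qed

lemma alpha0_ex1:
  assumes L: "gaussian_line L"
  shows "\<exists>!\<alpha>. is_alpha0 L \<alpha>"
proof (rule ex_ex1I)
  obtain z where z: "of_gauss z \<in> L"
    using L by (auto simp: gaussian_line_def)
  obtain x where x: "of_gauss x \<in> L"
    and least: "\<And>y. of_gauss y \<in> L \<Longrightarrow> nat (gnorm x) \<le> nat (gnorm y)"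
    using ex_has_least_nat[of "\<lambda>x. of_gauss x \<in> L" z "\<lambda>x. nat (gnorm x)"] z by blast
  define T where "T = {y. of_gauss y \<in> L \<and> gnorm y = gnorm x}"
  have "T \<subseteq> case_prod Gauss ` ({- gnorm x..gnorm x} \<times> {- gnorm x..gnorm x})"
  proof
    fix y assume "y \<in> T"
    then have n: "(gre y)\<^sup>2 + (gim y)\<^sup>2 = gnorm x"
      by (simp add: T_def gnorm_def)
    have sq: "\<bar>u\<bar> \<le> u\<^sup>2" for u :: int
      using self_le_power[of "\<bar>u\<bar>" 2] by (cases "u = 0") auto
    have "\<bar>gre y\<bar> \<le> gnorm x" "\<bar>gim y\<bar> \<le> gnorm x"
      using n sq[of "gre y"] sq[of "gim y"] zero_le_power2[of "gre y"] zero_le_power2[of "gim y"]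
      by linarith+
    then show "y \<in> case_prod Gauss ` ({- gnorm x..gnorm x} \<times> {- gnorm x..gnorm x})"
      by (intro image_eqI[of _ _ "(gre y, gim y)"]) auto
  qed
  then have "finite T"
    by (rule finite_subset) auto
  moreover have "T \<noteq> {}"
    using x by (auto simp: T_def)
  ultimately have "Max (gre ` T) \<in> gre ` T" "\<And>y. y \<in> T \<Longrightarrow> gre y \<le> Max (gre ` T)"
    by auto
  then obtain \<alpha> where \<alpha>: "\<alpha> \<in> T" "\<And>y. y \<in> T \<Longrightarrow> gre y \<le> gre \<alpha>"
    by (metis imageE)
  have "is_alpha0 L \<alpha>"
    unfolding is_alpha0_def
  proof (intro conjI allI impI)
    show "of_gauss \<alpha> \<in> L"
      using \<alpha> by (simp add: T_def)
    fix \<beta> assume \<beta>: "of_gauss \<beta> \<in> L"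
    have "gnorm \<alpha> \<le> gnorm \<beta>"
      using least[OF \<beta>] \<alpha>(1) gnorm_nonneg[of x] gnorm_nonneg[of \<beta>] by (simp add: T_def)
    then show "gnorm \<alpha> < gnorm \<beta> \<or> (gnorm \<alpha> = gnorm \<beta> \<and> gre \<beta> \<le> gre \<alpha>)"
      using \<alpha> \<beta> by (auto simp: T_def)
  qed
  then show "\<exists>\<alpha>. is_alpha0 L \<alpha>" ..
next
  fix x y assume xy: "is_alpha0 L x" "is_alpha0 L y"
  then have mem: "of_gauss x \<in> L" "of_gauss y \<in> L"
    by (simp_all add: is_alpha0_def)
  have least: "gnorm v < gnorm u \<or> (gnorm v = gnorm u \<and> gre u \<le> gre v)"
    if "is_alpha0 L v" "of_gauss u \<in> L" for u v
    using that by (simp add: is_alpha0_def)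
  have eq: "gnorm x = gnorm y" "gre x = gre y"
    using least[OF xy(1) mem(2)] least[OF xy(2) mem(1)] by linarith+
  show "x = y"
  proof (rule ccontr)
    assume "x \<noteq> y"
    with eq have im: "gim x \<noteq> gim y"
      by (metis gauss_int.expand)
    moreover have "(gim x)\<^sup>2 = (gim y)\<^sup>2"
      using eq by (simp add: gnorm_def)
    ultimately have neg: "gim y = - gim x" "gim x \<noteq> 0"
      by (auto simp: power2_eq_iff)
    have "(1/2) *\<^sub>R of_gauss x + (1/2) *\<^sub>R of_gauss y \<in> L"
      using L mem unfolding gaussian_line_def affine_def by (meson field_sum_of_halves)
    also have "(1/2) *\<^sub>R of_gauss x + (1/2) *\<^sub>R of_gauss y = of_gauss (Gauss (gre x) 0)"
      using neg eq by (simp add: of_gauss_def complex_eq_iff)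
    finally have "gnorm x \<le> gnorm (Gauss (gre x) 0)"
      using least[OF xy(1)] by fastforce
    with neg show False
      by (simp add: gnorm_def)
  qed
qed

lemma alpha1_ex1:
  assumes L: "gaussian_line L" and "\<not> vertical L"
  shows "\<exists>!\<alpha>. is_alpha1 L \<alpha>"
proof (rule ex_ex1I)
  have a0: "of_gauss (alpha0 L) \<in> L"
    using theI'[OF alpha0_ex1[OF L]] by (simp add: alpha0_def is_alpha0_def)
  obtain z w where zw: "z \<noteq> w" "of_gauss z \<in> L" "of_gauss w \<in> L"
    using L by (auto simp: gaussian_line_def)
  have "gre z \<noteq> gre w"
  proof
    assume "gre z = gre w"
    have "Re u = of_int (gre z)" if "u \<in> L" for u
      by (rule line_param[OF L zw(2,3) _ that])
         (use zw(1) \<open>gre z = gre w\<close> in \<open>auto simp: of_gauss_inj\<close>, simp add: of_gauss_def)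
    with \<open>\<not> vertical L\<close> show False
      by (auto simp: vertical_def)
  qed
  then obtain z w where zw: "gre z < gre w" "of_gauss z \<in> L" "of_gauss w \<in> L"
    using zw by (metis linorder_neqE)
  define y where "y = alpha0 L + (w - z)"
  have "1 *\<^sub>R of_gauss w + (-1) *\<^sub>R (of_gauss z - of_gauss (alpha0 L)) \<in> L"
    using mem_affine_3_minus[of L "of_gauss w" "of_gauss z" "of_gauss (alpha0 L)" "-1"]
      L zw a0 by (simp add: gaussian_line_def)
  then have y: "of_gauss y \<in> L" "gre (alpha0 L) < gre y"
    using zw by (simp_all add: y_def of_gauss_add of_gauss_diff algebra_simps)
  let ?P = "\<lambda>x. of_gauss x \<in> L \<and> gre (alpha0 L) < gre x"
  obtain x where x: "?P x"
    and least: "\<And>y. ?P y \<Longrightarrow> nat (gnorm (x - alpha0 L)) \<le> nat (gnorm (y - alpha0 L))"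
    using ex_has_least_nat[of ?P y "\<lambda>x. nat (gnorm (x - alpha0 L))"] y by blast
  have "gnorm (x - alpha0 L) \<le> gnorm (y - alpha0 L)" if "?P y" for y
    using least[OF that] gnorm_nonneg[of "y - alpha0 L"] by simp
  with x have "is_alpha1 L x"
    by (simp add: is_alpha1_def dist_of_gauss)
  then show "\<exists>\<alpha>. is_alpha1 L \<alpha>" ..
next
  have a0: "of_gauss (alpha0 L) \<in> L"
    using theI'[OF alpha0_ex1[OF L]] by (simp add: alpha0_def is_alpha0_def)
  fix x y assume xy: "is_alpha1 L x" "is_alpha1 L y"
  then have mem: "of_gauss x \<in> L" "of_gauss y \<in> L"
    and gt: "gre (alpha0 L) < gre x" "gre (alpha0 L) < gre y"
    and eq: "norm (of_gauss x - of_gauss (alpha0 L)) = norm (of_gauss y - of_gauss (alpha0 L))"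
    by (auto simp: is_alpha1_def dist_norm intro: antisym)
  have ne: "of_gauss (alpha0 L) \<noteq> of_gauss x"
    using gt by (auto simp: of_gauss_inj)
  obtain t :: real where t: "of_gauss y = of_gauss (alpha0 L) + of_real t * (of_gauss x - of_gauss (alpha0 L))"
    using line_param[OF L a0 mem(1) ne mem(2)] .
  then have "\<bar>t\<bar> = 1"
    using eq ne by (simp add: norm_mult)
  moreover have "Re (of_gauss y) - Re (of_gauss (alpha0 L)) = t * (Re (of_gauss x) - Re (of_gauss (alpha0 L)))"
    by (simp add: t)
  then have "t * of_int (gre x - gre (alpha0 L)) = of_int (gre y - gre (alpha0 L))"
    by (simp add: of_gauss_def)
  then have "t > 0"
    using gt by (metis of_int_0_less_iff diff_gt_0_iff_gt zero_less_mult_pos2)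
  ultimately have "t = 1" by simp
  with t show "x = y"
    by (simp add: of_gauss_inj)
qed

end

theory Submission
  imports Defs
begin

text \<open>
  The members of the divisor set are exactly the products r y with r a rational divisor of
  \<open>a d - b c\<close> and y a Gaussian integer without rational prime factors that is coprime to
  \<open>\<delta>\<close>. Indeed \<open>a d - b c\<close> is the determinant of any point of the line with \<open>\<delta>\<close>, so a
  rational integer dividing a point divides it, and c, d being coprime gives the converse.
  Modulo y every Gaussian integer is congruent to a rational one, so that a point with step
  \<open>\<delta>\<close> can be moved into the multiples of y without any use of the Chinese remainder theorem.
  Finally, having no rational prime factor means to contain \<open>1 + i\<close> at most once, no
  inert prime, and at most one of two conjugate primes.
\<close>

section \<open>Arithmetic of the Gaussian integers\<close>

lemma gauss_simps [simp]:
  "gre 0 = 0" "gim 0 = 0" "gre 1 = 1" "gim 1 = 0"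
  "gre (- x) = - gre x" "gim (- x) = - gim x"
  "gre (x * y) = gre x * gre y - gim x * gim y"
  "gim (x * y) = gre x * gim y + gim x * gre y"
  by (simp_all add: zero_gauss_int_def one_gauss_int_def uminus_gauss_int_def times_gauss_int_def)

lemma gauss_eq_iff: "x = y \<longleftrightarrow> gre x = gre y \<and> gim x = gim y"
  by (auto intro: gauss_int.expand)

lemma gauss_of_nat [simp]: "gre (of_nat n) = int n" "gim (of_nat n) = 0"
  by (induction n) auto

lemma gauss_of_int [simp]: "gre (of_int n) = n" "gim (of_int n) = 0"
  by (cases n; simp)+

lemma gauss_of_int_eq_0_iff [simp]: "of_int n = (0 :: gauss_int) \<longleftrightarrow> n = 0"
  by (simp add: gauss_eq_iff)

lemma gauss_numeral [simp]: "gre (numeral n) = numeral n" "gim (numeral n) = 0"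
  using gauss_of_int[of "numeral n"] by simp_all

lemma of_int_dvd_gauss_iff: "of_int q dvd (x :: gauss_int) \<longleftrightarrow> q dvd gre x \<and> q dvd gim x"
proof
  assume "q dvd gre x \<and> q dvd gim x"
  then obtain a b where "gre x = q * a" "gim x = q * b"
    by (auto elim!: dvdE)
  then have "x = of_int q * Gauss a b"
    by (simp add: gauss_eq_iff)
  then show "of_int q dvd x" by simp
qed (auto elim!: dvdE)

section \<open>Conjugation, norm, units and the prime above 2\<close>

definition gconj :: "gauss_int \<Rightarrow> gauss_int"
  where "gconj x = Gauss (gre x) (- gim x)"

lemma gconj_simps [simp]: "gre (gconj x) = gre x" "gim (gconj x) = - gim x"
  by (simp_all add: gconj_def)

lemma gconj_gconj [simp]: "gconj (gconj x) = x"
  by (simp add: gauss_eq_iff)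

lemma gconj_mult: "gconj (x * y) = gconj x * gconj y"
  by (simp add: gauss_eq_iff)

lemma gconj_of_int [simp]: "gconj (of_int n) = of_int n"
  by (simp add: gauss_eq_iff)

lemma gconj_dvd_gconj: "x dvd y \<Longrightarrow> gconj x dvd gconj y"
  by (auto simp: gconj_mult elim!: dvdE)

lemma gconj_dvd_iff: "gconj x dvd y \<longleftrightarrow> x dvd gconj y"
  using gconj_dvd_gconj[of "gconj x" y] gconj_dvd_gconj[of x "gconj y"] by auto

lemma mult_gconj: "x * gconj x = of_int (gnorm x)"
  by (simp add: gauss_eq_iff gnorm_def power2_eq_square)

lemma gnorm_gconj [simp]: "gnorm (gconj x) = gnorm x"
  by (simp add: gnorm_def)

lemma gnorm_mult: "gnorm (x * y) = gnorm x * gnorm y"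
  by (simp add: gnorm_def power2_eq_square algebra_simps)

lemma gnorm_eq_0_iff [simp]: "gnorm x = 0 \<longleftrightarrow> x = 0"
  by (simp add: gnorm_def sum_power2_eq_zero_iff gauss_eq_iff)

lemma gnorm_pos: "x \<noteq> 0 \<Longrightarrow> gnorm x > 0"
  using gnorm_nonneg[of x] gnorm_eq_0_iff[of x] by linarith

lemma gnorm_of_int [simp]: "gnorm (of_int n) = n\<^sup>2"
  by (simp add: gnorm_def)

lemma gnorm_dvd: "x dvd y \<Longrightarrow> gnorm x dvd gnorm y"
  by (auto simp: gnorm_mult elim!: dvdE)

lemma gauss_unit_iff: "x dvd 1 \<longleftrightarrow> gnorm x = 1"
proof
  assume "x dvd 1"
  then have "gnorm x dvd 1"
    using gnorm_dvd[of x 1] by (simp add: gnorm_def)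
  then show "gnorm x = 1"
    using gnorm_nonneg[of x] by (simp add: zdvd1_eq)
next
  assume "gnorm x = 1"
  then have "1 = x * gconj x" by (simp add: mult_gconj)
  then show "x dvd 1" ..
qed

lemma gauss_units: "gnorm x = 1 \<longleftrightarrow> x \<in> {1, -1, \<i>\<^sub>G, - \<i>\<^sub>G}"
proof
  assume n: "gnorm x = 1"
  have "(gre x)\<^sup>2 \<le> 1" "(gim x)\<^sup>2 \<le> 1"
    using n zero_le_power2[of "gre x"] zero_le_power2[of "gim x"] unfolding gnorm_def by linarith+
  then have "\<bar>gre x\<bar> \<le> 1" "\<bar>gim x\<bar> \<le> 1"
    by (simp_all add: abs_square_le_1)
  then have "gre x \<in> {-1, 0, 1}" "gim x \<in> {-1, 0, 1}"
    by auto
  with n show "x \<in> {1, -1, \<i>\<^sub>G, - \<i>\<^sub>G}"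
    by (auto simp: gauss_eq_iff gnorm_def)
qed (auto simp: gnorm_def)

text \<open>Supplies the decrease for the inductions and minimality arguments on the norm:
  cancelling a nonunit factor lowers it strictly.\<close>

lemma gnorm_less_mult:
  assumes "x \<noteq> 0" "y \<noteq> 0" "\<not> x dvd 1"
  shows "gnorm y < gnorm (x * y)"
proof -
  have "gnorm x > 1"
    using gnorm_pos[OF assms(1)] assms(3) by (simp add: gauss_unit_iff)
  then show ?thesis
    using gnorm_pos[OF assms(2)] by (simp add: gnorm_mult)
qed

text \<open>Modulo \<open>1 + i\<close> both 2 and \<open>1 + i\<close> vanish, so i is congruent to
  1 and only the parity of the coordinate sum survives.\<close>

lemma one_plus_i_dvd_iff: "1 + \<i>\<^sub>G dvd x \<longleftrightarrow> even (gre x + gim x)"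
proof
  assume "1 + \<i>\<^sub>G dvd x"
  then obtain y where "x = (1 + \<i>\<^sub>G) * y" ..
  then have "gre x + gim x = 2 * gre y" by simp
  then show "even (gre x + gim x)" by simp
next
  assume "even (gre x + gim x)"
  then obtain s where "gre x + gim x = 2 * s" ..
  then have "x = (1 + \<i>\<^sub>G) * Gauss s (gim x - s)"
    by (simp add: gauss_eq_iff)
  then show "1 + \<i>\<^sub>G dvd x" ..
qed

lemma one_plus_i_dvd_norm_2:
  assumes "gnorm x = 2"
  shows "1 + \<i>\<^sub>G dvd x"
proof -
  have "even ((gre x)\<^sup>2 + (gim x)\<^sup>2)"
    using assms by (simp add: gnorm_def)
  then show ?thesis by (simp add: one_plus_i_dvd_iff)
qed

lemma one_plus_i_not_unit: "\<not> 1 + \<i>\<^sub>G dvd 1"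
  by (simp add: one_plus_i_dvd_iff)

text \<open>The source of the bound \<open>t \<le> 1\<close>: two factors \<open>1 + i\<close>
  amount to the rational integer 2 up to a unit.\<close>

lemma one_plus_i_square: "(1 + \<i>\<^sub>G) * (1 + \<i>\<^sub>G) = of_int 2 * \<i>\<^sub>G"
  by (simp only: gauss_eq_iff) simp

section \<open>Euclidean division, Bezout identities and prime divisors\<close>

lemma gauss_division:
  assumes "y \<noteq> 0"
  obtains q where "gnorm (x - q * y) < gnorm y"
proof -
  define N where "N = gnorm y"
  have N: "N > 0" using gnorm_pos[OF assms] by (simp add: N_def)
  \<comment> \<open>Since \<open>x / y = W / N\<close>, dividing by \<open>y\<close> becomes
    rounding the two coordinates of \<open>W\<close> divided by the rational integer
    \<open>N\<close>.\<close>
  define W where "W = x * gconj y"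
  have near: "\<exists>s. 4 * (w - s * N)\<^sup>2 \<le> N\<^sup>2" for w
  proof -
    \<comment> \<open>This is \<open>w / N\<close> rounded to a nearest integer, so
      \<open>w - s * N\<close> is at most \<open>N / 2\<close> in absolute value. Two such errors
      have squares summing to at most half of the square of \<open>N\<close>.\<close>
    define s where "s = (2 * w + N) div (2 * N)"
    define r where "r = (2 * w + N) mod (2 * N)"
    have r: "0 \<le> r" "r < 2 * N" "2 * w + N = 2 * N * s + r"
      using N by (simp_all add: r_def s_def)
    have "\<bar>2 * (w - s * N)\<bar> \<le> \<bar>N\<bar>"
      using r by (simp add: algebra_simps)
    then have "(2 * (w - s * N))\<^sup>2 \<le> N\<^sup>2"
      by (simp add: abs_le_square_iff)
    then show ?thesis
      by (intro exI[of _ s]) (simp only: power_mult_distrib, simp)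
  qed
  obtain s t where st: "4 * (gre W - s * N)\<^sup>2 \<le> N\<^sup>2" "4 * (gim W - t * N)\<^sup>2 \<le> N\<^sup>2"
    using near by blast
  have "(x - Gauss s t * y) * gconj y = W - Gauss s t * of_int N"
    unfolding N_def W_def mult_gconj[symmetric] by (simp add: algebra_simps)
  then have "gnorm (x - Gauss s t * y) * N = gnorm (W - Gauss s t * of_int N)"
    by (metis N_def gnorm_gconj gnorm_mult)
  also have "\<dots> = (gre W - s * N)\<^sup>2 + (gim W - t * N)\<^sup>2"
    by (simp add: gnorm_def)
  also have "\<dots> < N\<^sup>2"
    using st zero_less_power[OF N, of 2] by linarith
  finally have "gnorm (x - Gauss s t * y) < N"
    using N by (simp add: power2_eq_square)
  then show ?thesis
    using that by (simp add: N_def)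
qed

text \<open>Take \<open>g\<close> of least norm among the nonzero elements of the ideal generated by
  \<open>x\<close> and \<open>y\<close>. Dividing a member of the ideal by \<open>g\<close> leaves a
  remainder in the ideal of smaller norm, which must be 0.\<close>

lemma gauss_bezout:
  obtains g u v :: gauss_int where "g = u * x + v * y" "g dvd x" "g dvd y"
proof (cases "x = 0 \<and> y = 0")
  case True
  then show ?thesis using that[of 0 0 0] by simp
next
  case False
  define I where "I = {u * x + v * y | u v. True}"
  have "x = 1 * x + 0 * y" "y = 0 * x + 1 * y" by simp_all
  then have xy: "x \<in> I" "y \<in> I" unfolding I_def by blast+
  then obtain z where "z \<in> I \<and> z \<noteq> 0" using False by auto
  then obtain g where g: "g \<in> I" "g \<noteq> 0"
    and least: "\<And>w. w \<in> I \<Longrightarrow> w \<noteq> 0 \<Longrightarrow> nat (gnorm g) \<le> nat (gnorm w)"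
    using ex_has_least_nat[of "\<lambda>w. w \<in> I \<and> w \<noteq> 0" z "\<lambda>w. nat (gnorm w)"] by blast
  have dvd: "g dvd w" if w: "w \<in> I" for w
  proof -
    obtain q where q: "gnorm (w - q * g) < gnorm g"
      using gauss_division[OF g(2)] .
    obtain u v u' v' where uv: "g = u * x + v * y" "w = u' * x + v' * y"
      using g(1) w unfolding I_def by blast
    have "w - q * g = (u' - q * u) * x + (v' - q * v) * y"
      unfolding uv by (simp add: algebra_simps)
    then have "w - q * g \<in> I" unfolding I_def by blast
    then have "w - q * g = 0"
      using q least[of "w - q * g"] gnorm_nonneg[of "w - q * g"] by linarith
    then have "w = g * q" by (simp add: mult.commute)
    then show ?thesis ..
  qed
  obtain u v where "g = u * x + v * y" using g(1) by (auto simp: I_def)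
  then show ?thesis using that dvd xy by blast
qed

text \<open>A nonunit divisor \<open>p\<close> of least norm is prime. If \<open>p\<close> does not
  divide \<open>a\<close>, then by minimality a gcd of \<open>p\<close> and \<open>a\<close> is a
  unit, and the Bezout identity times \<open>b\<close> shows that \<open>p\<close> divides
  \<open>b\<close>.\<close>

lemma gauss_prime_divisor:
  fixes x :: gauss_int
  assumes "x \<noteq> 0" "\<not> x dvd 1"
  obtains p where "prime_elem p" "p dvd x"
proof -
  obtain p where p: "p dvd x" "\<not> p dvd 1"
    and least: "\<And>w. w dvd x \<Longrightarrow> \<not> w dvd 1 \<Longrightarrow> nat (gnorm p) \<le> nat (gnorm w)"
    using ex_has_least_nat[of "\<lambda>w. w dvd x \<and> \<not> w dvd 1" x "\<lambda>w. nat (gnorm w)"] assms by auto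
  have p0: "p \<noteq> 0" using p assms by auto
  have "prime_elem p"
  proof (rule prime_elemI)
    fix a b assume ab: "p dvd a * b"
    show "p dvd a \<or> p dvd b"
    proof (cases "p dvd a")
      case False
      obtain g u v where g: "g = u * p + v * a" "g dvd p" "g dvd a"
        using gauss_bezout .
      have "g dvd 1"
      proof (rule ccontr)
        assume ng: "\<not> g dvd 1"
        obtain h where h: "p = g * h" using g(2) ..
        \<comment> \<open>With \<open>p = g * h\<close> this forces \<open>h\<close> to be a unit.
          Then \<open>p\<close> and \<open>g\<close> are associates, so \<open>p\<close> would
          divide \<open>a\<close>.\<close>
        have "gnorm p \<le> gnorm g"
          using least[OF dvd_trans[OF g(2) p(1)] ng] gnorm_nonneg[of g] by simp
        moreover have "h \<noteq> 0" "g \<noteq> 0" using h p0 by auto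
        ultimately have "h dvd 1"
          using gnorm_less_mult[of h g] unfolding h by (force simp only: mult.commute)
        then obtain w where w: "1 = h * w" ..
        have "g = g * (h * w)" by (simp flip: w)
        then have "g = p * w" by (simp only: h ac_simps)
        then have "p dvd g" ..
        with g(3) False dvd_trans show False by blast
      qed
      then obtain h where "1 = g * h" ..
      then have "b = b * (g * h)" by simp
      also have "\<dots> = p * (b * u * h) + (a * b) * (v * h)"
        unfolding g(1) by (simp add: algebra_simps)
      finally have eq: "p * (b * u * h) + (a * b) * (v * h) = b" ..
      have "p dvd b"
        using dvd_add[OF dvd_triv_left dvd_mult2[OF ab], of "b * u * h" "v * h"] unfolding eq .
      then show ?thesis ..
    qed simp
  qed (use p p0 in auto)
  then show ?thesis using that p by blast
qed

text \<open>Turns coprimality checked prime by prime into the Bezout identity that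
  \<open>divisor_set_iff\<close> asks for.\<close>

lemma gauss_coprime_bezout:
  fixes x y :: gauss_int
  assumes "x \<noteq> 0" and "\<And>p. prime_elem p \<Longrightarrow> p dvd x \<Longrightarrow> \<not> p dvd y"
  obtains u v where "u * x + v * y = 1"
proof -
  obtain g u v where g: "g = u * x + v * y" "g dvd x" "g dvd y"
    using gauss_bezout .
  have "g dvd 1"
  proof (rule ccontr)
    assume "\<not> g dvd 1"
    moreover have "g \<noteq> 0" using g(2) assms(1) by auto
    ultimately obtain p where "prime_elem p" "p dvd g"
      using gauss_prime_divisor by blast
    with g(2,3) assms(2) dvd_trans show False by blast
  qed
  then obtain h where "1 = g * h" ..
  then have "(h * u) * x + (h * v) * y = 1"
    unfolding g(1) by (simp add: algebra_simps)
  then show ?thesis using that by blast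
qed

section \<open>Associated and conjugate primes\<close>

lemma prime_elem_dvd_prime_elem:
  fixes p q :: "'a :: idom"
  assumes "prime_elem p" "prime_elem q" "p dvd q"
  shows "q dvd p"
proof -
  obtain s where s: "q = p * s" using assms(3) ..
  have "q dvd p \<or> q dvd s"
    using assms(2) s prime_elem_dvd_multD by (metis dvd_refl)
  \<comment> \<open>Otherwise cancelling \<open>q\<close> leaves \<open>1 = p * w\<close>, and the
    prime \<open>p\<close> would be a unit.\<close>
  moreover have "\<not> q dvd s"
  proof
    assume "q dvd s"
    then obtain w where "s = q * w" ..
    then have "q * 1 = q * (p * w)" using s by (metis mult.left_commute mult.right_neutral)
    then have "1 = p * w" using assms(2) by (metis mult_left_cancel prime_elem_def)
    then show False using assms(1) by (metis dvd_triv_left prime_elem_def)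
  qed
  ultimately show ?thesis by blast
qed

lemma prime_elem_dvd_prod_power:
  assumes "prime_elem p" "p dvd (\<Prod>j\<in>A. f j ^ k j)"
  obtains j where "j \<in> A" "p dvd f j"
proof -
  have "finite A \<Longrightarrow> p dvd (\<Prod>j\<in>A. f j ^ k j) \<Longrightarrow> \<exists>j\<in>A. p dvd f j"
  proof (induction A rule: finite_induct)
    case (insert i A)
    then have "p dvd f i ^ k i \<or> p dvd (\<Prod>j\<in>A. f j ^ k j)"
      using prime_elem_dvd_multD[OF assms(1)] by simp
    then show ?case
      using insert.IH prime_elem_dvd_power[OF assms(1)] by blast
  qed (use assms(1) in \<open>simp add: prime_elem_not_unit\<close>)
  \<comment> \<open>Over an infinite index set the product is 1 by convention, and no prime divides
    1.\<close>
  moreover have "finite A"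
    using assms by (cases "finite A") (auto simp: prime_elem_not_unit)
  ultimately show ?thesis using that assms(2) by blast
qed

lemma dvd_gnorm_eq:
  assumes "x dvd y" "y dvd x"
  shows "gnorm x = gnorm y"
  using gnorm_dvd[OF assms(1)] gnorm_dvd[OF assms(2)] gnorm_nonneg[of x] gnorm_nonneg[of y]
  by (simp add: zdvd_antisym_nonneg)

lemma prime_elem_gconj: "prime_elem x \<Longrightarrow> prime_elem (gconj x)"
  unfolding prime_elem_def gauss_unit_iff gconj_dvd_iff gconj_mult gnorm_gconj
  by (auto simp: gauss_eq_iff)

text \<open>If \<open>x\<close> is one of the four units times its conjugate, it lies on a
  coordinate axis or on a diagonal. The axes consist of associates of rational integers, and a prime
  on a diagonal has norm 2. Hence a split prime is never associated to its conjugate.\<close>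

lemma prime_elem_dvd_gconj_rational:
  assumes x: "prime_elem x" and dvd: "gconj x dvd x" and n2: "gnorm x \<noteq> 2"
  shows "\<not> non_rational x"
proof -
  have x0: "x \<noteq> 0" using x by (simp add: prime_elem_def)
  obtain u where u: "x = gconj x * u" using dvd ..
  then have "gnorm x * 1 = gnorm x * gnorm u"
    using gnorm_mult[of "gconj x" u] by simp
  then have "gnorm u = 1" using x0 by simp
  then have "u = 1 \<or> u = -1 \<or> u = \<i>\<^sub>G \<or> u = - \<i>\<^sub>G"
    using gauss_units by auto
  moreover have "gre x * gre u + gim x * gim u = gre x" "gre x * gim u - gim x * gre u = gim x"
    using arg_cong[OF u[symmetric], of gre] arg_cong[OF u[symmetric], of gim] by simp_all
  ultimately have cases: "gim x = 0 \<or> gre x = 0 \<or> gim x = gre x \<or> gim x = - gre x"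
    by auto
  have diag: False if "gim x = s * gre x" "s\<^sup>2 = 1" for s
  proof -
    have n: "gnorm x = 2 * (gre x)\<^sup>2"
      using that by (simp add: gnorm_def power_mult_distrib)
    have re0: "gre x \<noteq> 0" using n x0 gnorm_pos[OF x0] by auto
    \<comment> \<open>Being prime, \<open>x\<close> divides one of these two factors. Its norm is
      twice the square of \<open>gre x\<close>, which cannot divide that square, and which divides 2
      only if it equals 2.\<close>
    have "of_int (gre x) * Gauss 1 s = x"
      using that by (simp add: gauss_eq_iff)
    then have "x dvd of_int (gre x) * Gauss 1 s" by simp
    then have "x dvd of_int (gre x) \<or> x dvd Gauss 1 s"
      by (rule prime_elem_dvd_multD[OF x])
    then have "2 * (gre x)\<^sup>2 dvd (gre x)\<^sup>2 \<or> 2 * (gre x)\<^sup>2 dvd 2"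
      using gnorm_dvd[of x "of_int (gre x)"] gnorm_dvd[of x "Gauss 1 s"] n that(2)
      by (auto simp: gnorm_def[of "Gauss 1 s"])
    then show False
    proof
      assume "2 * (gre x)\<^sup>2 dvd (gre x)\<^sup>2"
      then show False using re0 by (auto dest!: zdvd_imp_le)
    next
      assume "2 * (gre x)\<^sup>2 dvd 2"
      then have "(gre x)\<^sup>2 \<le> 1" by (auto dest: zdvd_imp_le)
      moreover have "(gre x)\<^sup>2 > 0" using re0 by simp
      ultimately have "(gre x)\<^sup>2 = 1" by linarith
      with n n2 show False by simp
    qed
  qed
  have "gim x = 0 \<or> gre x = 0"
    using cases diag[of 1] diag[of "-1"] by auto
  then show ?thesis
  proof
    assume "gim x = 0"
    then have "of_int (gre x) = x" by (simp add: gauss_eq_iff)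
    then have "x dvd of_int (gre x)" "of_int (gre x) dvd x" by simp_all
    then show ?thesis unfolding non_rational_def by blast
  next
    assume "gre x = 0"
    then have "of_int (gim x) * \<i>\<^sub>G = x" "x * (- \<i>\<^sub>G) = of_int (gim x)"
      by (simp_all add: gauss_eq_iff)
    then have "x dvd of_int (gim x)" "of_int (gim x) dvd x"
      by (metis dvd_triv_left)+
    then show ?thesis unfolding non_rational_def by blast
  qed
qed

lemma gauss_split_power:
  fixes p x :: gauss_int
  assumes "x \<noteq> 0" "p \<noteq> 0" "\<not> p dvd 1"
  obtains k y where "x = p ^ k * y" "\<not> p dvd y"
proof -
  have "\<exists>k y. x = p ^ k * y \<and> \<not> p dvd y"
    using assms(1)
  proof (induction "nat (gnorm x)" arbitrary: x rule: less_induct)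
    case less
    show ?case
    proof (cases "p dvd x")
      case True
      then obtain z where z: "x = p * z" ..
      with less.prems have "z \<noteq> 0" by auto
      then have "nat (gnorm z) < nat (gnorm x)"
        using gnorm_less_mult[OF assms(2) _ assms(3), of z] gnorm_nonneg[of z] by (simp add: z)
      with less.hyps \<open>z \<noteq> 0\<close> obtain k y where "z = p ^ k * y" "\<not> p dvd y" by blast
      then have "x = p ^ Suc k * y" by (simp add: z algebra_simps)
      with \<open>\<not> p dvd y\<close> show ?thesis by blast
    next
      case False
      then show ?thesis by (intro exI[of _ 0] exI[of _ x]) auto
    qed
  qed
  then show ?thesis using that by blast
qed

section \<open>Primitive Gaussian integers\<close>

text \<open>Links two forms of primitivity: coprime coordinates give a Bezout identity over the
  integers, while the absence of rational divisors visibly passes to divisors.\<close>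

lemma coprime_parts_iff: "coprime (gre x) (gim x) \<longleftrightarrow> (\<forall>q. of_int q dvd x \<longrightarrow> \<bar>q\<bar> = 1)"
proof
  assume "coprime (gre x) (gim x)"
  then show "\<forall>q. of_int q dvd x \<longrightarrow> \<bar>q\<bar> = 1"
    using coprime_common_divisor[of "gre x" "gim x"] by (simp add: of_int_dvd_gauss_iff)
next
  assume "\<forall>q. of_int q dvd x \<longrightarrow> \<bar>q\<bar> = 1"
  moreover have "of_int (gcd (gre x) (gim x)) dvd x"
    by (simp add: of_int_dvd_gauss_iff)
  ultimately have "\<bar>gcd (gre x) (gim x)\<bar> = 1" by blast
  then show "coprime (gre x) (gim x)" by (simp add: coprime_iff_gcd_eq_1)
qed

lemma coprime_parts_dvd:
  assumes "coprime (gre x) (gim x)" "y dvd x"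
  shows "coprime (gre y) (gim y)"
  using assms unfolding coprime_parts_iff by (meson dvd_trans)

text \<open>A Bezout identity for the coordinates of \<open>y\<close> yields the multiple
  \<open>y * Gauss v u\<close> with imaginary part 1 and real part \<open>s\<close>. So i is
  congruent to \<open>- s\<close> modulo \<open>y\<close>, and substituting this in \<open>x\<close>
  gives the rational residue.\<close>

lemma primitive_residue_rational:
  assumes "coprime (gre y) (gim y)"
  obtains n :: int where "y dvd x - of_int n"
proof -
  obtain u v where uv: "u * gre y + v * gim y = 1"
    using assms by (metis bezout_int coprime_iff_gcd_eq_1)
  define s where "s = v * gre y - u * gim y"
  have "\<i>\<^sub>G + of_int s = y * Gauss v u"
    using uv by (simp add: gauss_eq_iff s_def algebra_simps)
  moreover have "x - of_int (gre x - s * gim x) = (\<i>\<^sub>G + of_int s) * of_int (gim x)"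
    by (simp add: gauss_eq_iff)
  ultimately have "x - of_int (gre x - s * gim x) = y * (Gauss v u * of_int (gim x))"
    by (simp only: mult.assoc)
  then show ?thesis using that by (metis dvd_triv_left)
qed

text \<open>Modulo \<open>y\<close>, \<open>v\<close> is an inverse of \<open>d\<close>, so
  \<open>n\<close> only has to be congruent to \<open>- (v * x)\<close>. Primitivity of
  \<open>y\<close> allows a rational integer there.\<close>

lemma primitive_dvd_progression:
  assumes "coprime (gre y) (gim y)" and "u * y + v * d = 1"
  obtains n :: int where "y dvd x + d * of_int n"
proof -
  obtain n where "y dvd - (v * x) - of_int n"
    using primitive_residue_rational[OF assms(1)] .
  then obtain w where w: "- (v * x) - of_int n = y * w" ..
  have "x + d * of_int n = x - d * (v * x + y * w)"
    by (simp flip: w)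
  also have "\<dots> = (u * y + v * d) * x - d * (v * x + y * w)"
    by (simp add: assms(2))
  also have "\<dots> = y * (u * x - d * w)"
    by (simp add: algebra_simps)
  finally have "y dvd x + d * of_int n" ..
  then show ?thesis by (rule that)
qed

text \<open>The conditions on the primes in the theorem that do not mention \<open>delta L\<close>.
  They leave the primes above rational primes congruent to 1 modulo 4; distinct norms exclude
  repetition of a prime, up to associates, and the presence of both conjugates.\<close>

definition split_primes :: "nat \<Rightarrow> (nat \<Rightarrow> gauss_int) \<Rightarrow> bool"
  where "split_primes m \<pi> \<longleftrightarrow>
    (\<forall>j\<in>{1..m}. prime_elem (\<pi> j) \<and> non_rational (\<pi> j) \<and> gnorm (\<pi> j) \<noteq> 2 \<and>
       (\<forall>n\<in>{1..m}. j \<noteq> n \<longrightarrow> gnorm (\<pi> j) \<noteq> gnorm (\<pi> n)))"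

lemma prime_not_dvd_one_plus_i:
  assumes "prime_elem p" "gnorm p \<noteq> 2"
  shows "\<not> p dvd 1 + \<i>\<^sub>G"
proof
  assume "p dvd 1 + \<i>\<^sub>G"
  then have "gnorm p dvd 2"
    using gnorm_dvd[of p "1 + \<i>\<^sub>G"] by (simp add: gnorm_def)
  then have "gnorm p \<le> 2" by (auto dest: zdvd_imp_le)
  moreover have "gnorm p > 0" "gnorm p \<noteq> 1"
    using assms(1) gnorm_pos[of p] by (auto simp: prime_elem_def gauss_unit_iff)
  ultimately show False using assms(2) by linarith
qed

lemma prime_dvd_factored:
  assumes "prime_elem p" "p dvd (1 + \<i>\<^sub>G) ^ t * (\<Prod>j\<in>A. \<pi> j ^ k j)"
  obtains "t > 0" "p dvd 1 + \<i>\<^sub>G" | j where "j \<in> A" "p dvd \<pi> j"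
proof -
  consider "p dvd (1 + \<i>\<^sub>G) ^ t" | "p dvd (\<Prod>j\<in>A. \<pi> j ^ k j)"
    using assms prime_elem_dvd_multD by blast
  then show ?thesis
  proof cases
    case 1
    then have "t > 0" using assms(1) by (cases t) (auto simp: prime_elem_not_unit)
    then show ?thesis using that(1) 1 assms(1) prime_elem_dvd_power by blast
  next
    case 2
    then show ?thesis using that(2) prime_elem_dvd_prod_power[OF assms(1)] by blast
  qed
qed

text \<open>A rational nonunit \<open>q\<close> dividing \<open>y\<close> has a Gaussian prime
  divisor \<rho>, which must divide some \<open>\<pi> j\<close> or \<open>1 + i\<close>. The first
  case would bring in the conjugate prime as well, the second a second factor
  \<open>1 + i\<close>.\<close>

lemma primitive_factored:
  fixes k :: "nat \<Rightarrow> nat"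
  assumes \<pi>: "split_primes m \<pi>" and t: "t \<le> 1"
  defines "y \<equiv> (1 + \<i>\<^sub>G) ^ t * (\<Prod>j\<in>{1..m}. \<pi> j ^ k j)"
  shows "coprime (gre y) (gim y)"
proof (rule ccontr)
  let ?P = "\<Prod>j\<in>{1..m}. \<pi> j ^ k j"
  have pr: "prime_elem (\<pi> j)" "non_rational (\<pi> j)" "gnorm (\<pi> j) \<noteq> 2" if "j \<in> {1..m}" for j
    using \<pi> that by (auto simp: split_primes_def)
  have y0: "y \<noteq> 0"
    using pr(1) by (auto simp: y_def prime_elem_def gauss_eq_iff[of "1 + \<i>\<^sub>G"])
  assume "\<not> coprime (gre y) (gim y)"
  then obtain q where q: "of_int q dvd y" "\<bar>q\<bar> \<noteq> 1"
    by (auto simp: coprime_parts_iff)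
  have "of_int q \<noteq> (0 :: gauss_int)" using q(1) y0 by auto
  moreover have "\<not> of_int q dvd (1 :: gauss_int)"
    using q(2) by (simp add: of_int_dvd_gauss_iff)
  ultimately obtain \<rho> :: gauss_int where \<rho>: "prime_elem \<rho>" "\<rho> dvd of_int q"
    using gauss_prime_divisor by blast
  have split: False if "j \<in> {1..m}" "\<rho> dvd \<pi> j" for j
  proof -
    \<comment> \<open>As \<open>q\<close> is its own conjugate, \<open>gconj (\<pi> j)\<close>
      divides it too, and thus divides \<open>y\<close>. Comparing norms, it can only divide
      \<open>\<pi> j\<close> itself.\<close>
    have "\<pi> j dvd of_int q"
      using prime_elem_dvd_prime_elem[OF \<rho>(1) pr(1) that(2)] that(1) \<rho>(2) dvd_trans by blast
    then have "gconj (\<pi> j) dvd y"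
      using q(1) dvd_trans by (metis gconj_dvd_iff gconj_of_int)
    moreover have pc: "prime_elem (gconj (\<pi> j))"
      using pr(1) that(1) prime_elem_gconj by blast
    ultimately consider "gconj (\<pi> j) dvd 1 + \<i>\<^sub>G" | n where "n \<in> {1..m}" "gconj (\<pi> j) dvd \<pi> n"
      unfolding y_def by (elim prime_dvd_factored[rotated])
    then show False
    proof cases
      case 1
      then show False
        using prime_not_dvd_one_plus_i[OF pc] pr(3) that(1) by simp
    next
      case 2
      then have "gnorm (\<pi> n) = gnorm (\<pi> j)"
        using dvd_gnorm_eq[OF 2(2) prime_elem_dvd_prime_elem[OF pc pr(1)[OF 2(1)] 2(2)]] by simp
      with \<pi> 2 that have "n = j" unfolding split_primes_def by metis
      then show False
        using prime_elem_dvd_gconj_rational[OF pr(1)] pr 2 that by blast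
    qed
  qed
  from \<rho> q have "\<rho> dvd y" using dvd_trans by blast
  with \<rho>(1) show False unfolding y_def
  proof (cases rule: prime_dvd_factored)
    case 1
    with t have "t = 1" by simp
    \<comment> \<open>So \<open>q\<close> is even, and 2, an associate of the square of
      \<open>1 + i\<close>, divides \<open>y\<close>. Cancelling the single factor
      \<open>1 + i\<close> of \<open>y\<close> sends \<rho> into the product of the
      \<open>\<pi> j\<close>, which is the case already refuted.\<close>
    have "gnorm \<rho> = 2"
      using prime_not_dvd_one_plus_i[OF \<rho>(1)] 1 by blast
    then have "even (q\<^sup>2)"
      using gnorm_dvd[OF \<rho>(2)] by simp
    then have "of_int 2 dvd y"
      using q(1) unfolding of_int_dvd_gauss_iff by (auto intro: dvd_trans)
    then have "(1 + \<i>\<^sub>G) * (1 + \<i>\<^sub>G) dvd (1 + \<i>\<^sub>G) * (?P * \<i>\<^sub>G)"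
      unfolding one_plus_i_square by (simp add: y_def \<open>t = 1\<close> mult_dvd_mono flip: mult.assoc)
    then have "1 + \<i>\<^sub>G dvd ?P * \<i>\<^sub>G"
      by (subst (asm) dvd_mult_cancel_left) (auto simp: gauss_eq_iff)
    then have "\<rho> dvd ?P \<or> \<rho> dvd \<i>\<^sub>G"
      using 1 \<rho>(1) dvd_trans prime_elem_dvd_multD by blast
    moreover have "\<not> \<rho> dvd \<i>\<^sub>G"
      using gnorm_dvd[of \<rho> "\<i>\<^sub>G"] \<open>gnorm \<rho> = 2\<close> by (auto simp: gnorm_def)
    ultimately show False
      using split prime_elem_dvd_prod_power[OF \<rho>(1)] by metis
  next
    case (2 j)
    then show False using split by blast
  qed
qed

text \<open>Induction on the norm, splitting off one factor \<open>1 + i\<close> or the full power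
  of another prime. The clauses saying that the factors divide \<open>x\<close> serve to exclude
  conjugates in the induction and, later, to transfer coprimality with \<open>delta L\<close> to
  each factor.\<close>

lemma primitive_factorization:
  assumes "coprime (gre x) (gim x)"
  shows "\<exists>\<mu> t m \<pi> k. x = \<mu> * (1 + \<i>\<^sub>G) ^ t * (\<Prod>j\<in>{1..m}. \<pi> j ^ k j) \<and> gnorm \<mu> = 1 \<and>
    t \<le> 1 \<and> (t = 1 \<longrightarrow> 1 + \<i>\<^sub>G dvd x) \<and> split_primes m \<pi> \<and> (\<forall>j\<in>{1..m}. \<pi> j dvd x)"
  using assms
proof (induction "nat (gnorm x)" arbitrary: x rule: less_induct)
  case less
  have x0: "x \<noteq> 0" using less.prems by auto
  consider "x dvd 1" | "1 + \<i>\<^sub>G dvd x" | "\<not> x dvd 1" "\<not> 1 + \<i>\<^sub>G dvd x" by blast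
  then show ?case
  proof cases
    case 1
    then show ?thesis
      by (intro exI[of _ x] exI[of _ 0] exI[of _ "\<lambda>_. 0"] exI[of _ "\<lambda>_. 0 :: nat"])
         (simp add: gauss_unit_iff split_primes_def)
  next
    case 2
    then obtain y where y: "x = (1 + \<i>\<^sub>G) * y" ..
    have "y dvd x" using y by simp
    have "nat (gnorm y) < nat (gnorm x)"
      using gnorm_less_mult[of "1 + \<i>\<^sub>G" y] x0 y one_plus_i_not_unit gnorm_nonneg[of y] by auto
    then obtain \<mu> t m \<pi> k where *: "y = \<mu> * (1 + \<i>\<^sub>G) ^ t * (\<Prod>j\<in>{1..m}. \<pi> j ^ k j)" "gnorm \<mu> = 1"
      "t \<le> 1" "t = 1 \<longrightarrow> 1 + \<i>\<^sub>G dvd y" "split_primes m \<pi>" "\<forall>j\<in>{1..m}. \<pi> j dvd y"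
      using less.hyps coprime_parts_dvd[OF less.prems \<open>y dvd x\<close>] by blast
    \<comment> \<open>A second factor \<open>1 + i\<close> would make 2 divide the primitive
      \<open>x\<close>.\<close>
    have "\<not> 1 + \<i>\<^sub>G dvd y"
    proof
      assume "1 + \<i>\<^sub>G dvd y"
      then have "of_int 2 * \<i>\<^sub>G dvd x"
        unfolding y one_plus_i_square[symmetric] by (rule mult_dvd_mono[OF dvd_refl])
      then have "of_int 2 dvd x" by (rule dvd_mult_left)
      with less.prems show False unfolding coprime_parts_iff by fastforce
    qed
    with *(3,4) have "t = 0" by linarith
    then have "x = \<mu> * (1 + \<i>\<^sub>G) ^ 1 * (\<Prod>j\<in>{1..m}. \<pi> j ^ k j)"
      unfolding y by (subst *(1)) simp
    moreover have "\<forall>j\<in>{1..m}. \<pi> j dvd x"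
      using *(6) \<open>y dvd x\<close> dvd_trans by blast
    ultimately show ?thesis
      using *(2,5) 2 by blast
  next
    case 3
    obtain p where p: "prime_elem p" "p dvd x"
      using gauss_prime_divisor x0 3 by blast
    have p': "p \<noteq> 0" "\<not> p dvd 1" using p by (auto simp: prime_elem_def)
    have "gnorm p \<noteq> 2"
    proof
      assume "gnorm p = 2"
      then have "1 + \<i>\<^sub>G dvd p" by (rule one_plus_i_dvd_norm_2)
      then show False using 3 p dvd_trans by blast
    qed
    have "non_rational p"
      unfolding non_rational_def
    proof
      assume "\<exists>q :: int. p dvd of_int q \<and> of_int q dvd p"
      then obtain q :: int where q: "p dvd of_int q" "of_int q dvd p" by blast
      with p less.prems have "\<bar>q\<bar> = 1" unfolding coprime_parts_iff by (meson dvd_trans)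
      with q(1) p'(2) show False by (auto simp: abs_if split: if_splits)
    qed
    obtain l y where y: "x = p ^ l * y" "\<not> p dvd y"
      using gauss_split_power x0 p' by blast
    have "l > 0" using y p by (cases l) auto
    have "y dvd x" using y by simp
    have "\<not> p ^ l dvd 1" using p'(2) \<open>l > 0\<close>
      by (meson dvd_power dvd_trans)
    then have "nat (gnorm y) < nat (gnorm x)"
      using gnorm_less_mult[of "p ^ l" y] x0 y gnorm_nonneg[of y] by auto
    then obtain \<mu> t m \<pi> k where *: "y = \<mu> * (1 + \<i>\<^sub>G) ^ t * (\<Prod>j\<in>{1..m}. \<pi> j ^ k j)" "gnorm \<mu> = 1"
      "t \<le> 1" "t = 1 \<longrightarrow> 1 + \<i>\<^sub>G dvd y" "split_primes m \<pi>" "\<forall>j\<in>{1..m}. \<pi> j dvd y"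
      using less.hyps coprime_parts_dvd[OF less.prems \<open>y dvd x\<close>] by blast
    \<comment> \<open>A \<open>\<pi> j\<close> with the norm of \<open>p\<close> is an associate of
      \<open>p\<close> or of its conjugate. The first is impossible as \<open>p\<close> does not
      divide \<open>y\<close>. In the second, \<open>p ^ l\<close> and \<open>y\<close> contribute
      conjugate factors whose product is the rational integer \<open>gnorm p\<close>, against
      primitivity of \<open>x\<close>.\<close>
    have new: "\<forall>j\<in>{1..m}. gnorm (\<pi> j) \<noteq> gnorm p"
    proof (intro ballI notI)
      fix j assume j: "j \<in> {1..m}"
      assume eq: "gnorm (\<pi> j) = gnorm p"
      have pj: "prime_elem (\<pi> j)" using * j by (auto simp: split_primes_def)
      have "p dvd \<pi> j * gconj (\<pi> j)"
        unfolding mult_gconj eq by (simp flip: mult_gconj)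
      then consider "p dvd \<pi> j" | "p dvd gconj (\<pi> j)"
        using p prime_elem_dvd_multD by blast
      then show False
      proof cases
        case 1
        then show False using * j y(2) dvd_trans by blast
      next
        case 2
        then have "gconj (\<pi> j) dvd p"
          using prime_elem_dvd_prime_elem[OF p(1) prime_elem_gconj[OF pj]] by blast
        also have "p dvd p ^ l" using \<open>l > 0\<close> by simp
        finally have "gconj (\<pi> j) * \<pi> j dvd x"
          unfolding y(1) using * j by (intro mult_dvd_mono) auto
        then have "of_int (gnorm p) dvd x"
          by (simp add: mult_gconj mult.commute flip: eq)
        then have "gnorm p = 1"
          using less.prems gnorm_nonneg[of p] unfolding coprime_parts_iff by fastforce
        with p' show False by (simp add: gauss_unit_iff)
      qed
    qed
    define \<pi>' k' where "\<pi>' = \<pi>(Suc m := p)" and "k' = k(Suc m := l)"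
    have "(\<Prod>j\<in>{1..m}. \<pi>' j ^ k' j) = (\<Prod>j\<in>{1..m}. \<pi> j ^ k j)"
      by (intro prod.cong) (auto simp: \<pi>'_def k'_def)
    then have prod: "(\<Prod>j\<in>{1..Suc m}. \<pi>' j ^ k' j) = (\<Prod>j\<in>{1..m}. \<pi> j ^ k j) * p ^ l"
      by (simp add: \<pi>'_def k'_def)
    have "x = \<mu> * (1 + \<i>\<^sub>G) ^ t * (\<Prod>j\<in>{1..Suc m}. \<pi>' j ^ k' j)"
      unfolding prod y(1) by (subst *(1)) (simp only: ac_simps)
    moreover have "split_primes (Suc m) \<pi>'"
      using *(5) new p(1) \<open>non_rational p\<close> \<open>gnorm p \<noteq> 2\<close>
      by (auto simp: split_primes_def \<pi>'_def le_Suc_eq)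
    moreover have "\<forall>j\<in>{1..Suc m}. \<pi>' j dvd x"
      using *(6) p(2) \<open>y dvd x\<close> dvd_trans by (auto simp: \<pi>'_def le_Suc_eq)
    moreover have "t = 1 \<longrightarrow> 1 + \<i>\<^sub>G dvd x"
      using *(4) \<open>y dvd x\<close> dvd_trans by blast
    ultimately show ?thesis using *(2,3) by blast
  qed
qed

section \<open>Gaussian integers on a line\<close>

lemma alpha0_in_line: "gaussian_line L \<Longrightarrow> of_gauss (alpha0 L) \<in> L"
  using theI'[OF alpha0_ex1] by (simp add: alpha0_def is_alpha0_def)

text \<open>If \<open>g > 1\<close> divides \<open>delta L = g * e\<close>, then going the fraction
  \<open>1 / g\<close> of the way from \<open>alpha0 L\<close> to the next point reaches
  \<open>alpha0 L + e\<close>. This point is closer to \<open>alpha0 L\<close> and still has larger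
  real part, against the choice of that next point.\<close>

lemma delta_coprime_parts:
  assumes L: "gaussian_line L"
  shows "coprime (gre (delta L)) (gim (delta L))"
proof (cases "vertical L")
  case False
  define x where "x = (THE \<alpha>. is_alpha1 L \<alpha>)"
  have x: "is_alpha1 L x"
    unfolding x_def by (rule theI'[OF alpha1_ex1[OF L False]])
  have d: "delta L = x - alpha0 L" using False by (simp add: delta_def x_def)
  show ?thesis
  proof (rule ccontr)
    assume nc: "\<not> coprime (gre (delta L)) (gim (delta L))"
    define g where "g = gcd (gre (delta L)) (gim (delta L))"
    have re: "gre (delta L) > 0" using x d by (simp add: is_alpha1_def)
    then have "g > 0" by (simp add: g_def)
    moreover have "g \<noteq> 1" using nc by (simp add: g_def coprime_iff_gcd_eq_1)
    ultimately have g: "g > 1" by linarith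
    have "of_int g dvd delta L" by (simp add: of_int_dvd_gauss_iff g_def)
    then obtain e where e: "delta L = of_int g * e" ..
    have e0: "e \<noteq> 0" using e re by auto
    have "(1 - 1 / of_int g) *\<^sub>R of_gauss (alpha0 L) + (1 / of_int g) *\<^sub>R of_gauss x \<in> L"
      using L x alpha0_in_line[OF L] by (intro mem_affine) (auto simp: gaussian_line_def is_alpha1_def)
    also have "(1 - 1 / of_int g) *\<^sub>R of_gauss (alpha0 L) + (1 / of_int g) *\<^sub>R of_gauss x
        = of_gauss (alpha0 L + e)"
    proof -
      have "x = alpha0 L + of_int g * e" using d e by (metis add_diff_cancel_left' diff_add_cancel add.commute)
      then show ?thesis using g
        by (simp add: of_gauss_def complex_eq_iff field_simps)
    qed
    finally have mem: "of_gauss (alpha0 L + e) \<in> L" .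
    have "gre e > 0" using e re g by (simp add: zero_less_mult_iff)
    then have "gnorm (x - alpha0 L) \<le> gnorm e"
      using x mem unfolding is_alpha1_def dist_of_gauss
      by (metis add_diff_cancel_left' gre_gim_simps(1) less_add_same_cancel1 of_int_le_iff real_sqrt_le_iff)
    then have "gnorm (of_int g * e) \<le> gnorm e" using d e by simp
    moreover have "\<not> of_int g dvd (1 :: gauss_int)" "of_int g \<noteq> (0 :: gauss_int)"
      using g by (auto simp: of_int_dvd_gauss_iff)
    ultimately show False using gnorm_less_mult[of "of_int g" e] e0 by simp
  qed
qed (simp add: delta_def)

text \<open>Off the vertical case, the real parameter \<open>t\<close> of \<open>x\<close> is an
  integer: a Bezout identity for the coordinates of \<open>delta L\<close> writes \<open>t\<close>
  as an integral combination of the coordinates of \<open>x - alpha0 L\<close>.\<close>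

lemma line_point_exhaust:
  assumes L: "gaussian_line L" and x: "of_gauss x \<in> L"
  obtains n where "x = line_point L n"
proof (cases "vertical L")
  case True
  then have "Re (of_gauss x) = Re (of_gauss (alpha0 L))"
    using x alpha0_in_line[OF L] unfolding vertical_def by blast
  then have "x = line_point L (gim x - gim (alpha0 L))"
    using True by (simp add: line_point_def delta_def gauss_eq_iff of_gauss_def)
  then show ?thesis using that by blast
next
  case False
  define y where "y = (THE \<alpha>. is_alpha1 L \<alpha>)"
  have y: "is_alpha1 L y"
    unfolding y_def by (rule theI'[OF alpha1_ex1[OF L False]])
  have d: "delta L = y - alpha0 L" using False by (simp add: delta_def y_def)
  have ne: "of_gauss (alpha0 L) \<noteq> of_gauss y" and mem: "of_gauss y \<in> L"
    using y by (auto simp: is_alpha1_def of_gauss_inj)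
  obtain t :: real where "of_gauss x = of_gauss (alpha0 L) + of_real t * (of_gauss y - of_gauss (alpha0 L))"
    using line_param[OF L alpha0_in_line[OF L] mem ne x] .
  then have "of_gauss (x - alpha0 L) = of_real t * of_gauss (delta L)"
    by (simp add: of_gauss_diff d)
  then have t: "of_int (gre (x - alpha0 L)) = t * of_int (gre (delta L))"
      "of_int (gim (x - alpha0 L)) = t * of_int (gim (delta L))"
    by (simp_all add: of_gauss_def complex_eq_iff del: gre_gim_simps)
  obtain u v where uv: "u * gre (delta L) + v * gim (delta L) = 1"
    using delta_coprime_parts[OF L] by (metis bezout_int coprime_iff_gcd_eq_1)
  define n where "n = u * gre (x - alpha0 L) + v * gim (x - alpha0 L)"
  have "of_int n = t * of_int (u * gre (delta L) + v * gim (delta L))"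
    unfolding n_def by (simp add: t algebra_simps del: gre_gim_simps)
  then have n: "t = of_int n" unfolding uv by simp
  have "gre (x - alpha0 L) = n * gre (delta L)" "gim (x - alpha0 L) = n * gim (delta L)"
    using t unfolding n by (simp_all del: gre_gim_simps flip: of_int_mult)
  then have "x = line_point L n"
    by (simp add: line_point_def gauss_eq_iff algebra_simps)
  then show ?thesis using that by blast
qed

text \<open>A common divisor of \<open>alpha0 L\<close> and \<open>delta L\<close> divides every
  Gaussian integer on the line, so primitivity makes their gcd a unit.\<close>

lemma primitive_line_bezout:
  assumes "gaussian_line L" "primitive_line L"
  obtains u v where "u * alpha0 L + v * delta L = 1"
proof -
  obtain g u v where g: "g = u * alpha0 L + v * delta L" "g dvd alpha0 L" "g dvd delta L"
    using gauss_bezout .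
  have "g dvd \<alpha>" if "of_gauss \<alpha> \<in> L" for \<alpha>
    using line_point_exhaust[OF assms(1) that] g by (metis dvd_add dvd_mult2 line_point_def)
  then have "g dvd 1" using assms(2) unfolding primitive_line_def by blast
  then obtain h where "1 = g * h" ..
  then have "(h * u) * alpha0 L + (h * v) * delta L = 1"
    unfolding g(1) by (simp add: algebra_simps)
  then show ?thesis using that by blast
qed

text \<open>The Bezout identity expresses that \<open>y\<close> is coprime to
  \<open>delta L\<close>, in the form needed by \<open>primitive_dvd_progression\<close>. From left
  to right, \<open>r\<close> is the gcd of the coordinates of \<beta>.\<close>

lemma divisor_set_iff:
  assumes L: "gaussian_line L" "primitive_line L"
    and ab: "alpha0 L = Gauss a b" "delta L = Gauss c d" and \<Delta>: "a * d - b * c \<noteq> 0"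
  shows "\<beta> \<in> divisor_set L \<longleftrightarrow>
    (\<exists>r y u v. \<beta> = of_int r * y \<and> r dvd a * d - b * c \<and> coprime (gre y) (gim y) \<and>
       u * y + v * delta L = 1)"
proof
  assume "\<beta> \<in> divisor_set L"
  then obtain n where n: "\<beta> dvd line_point L n" by (auto simp: divisor_set_def)
  have det: "gre (line_point L n) * d - gim (line_point L n) * c = a * d - b * c"
    by (simp add: line_point_def ab algebra_simps)
  have \<beta>0: "\<beta> \<noteq> 0" using n det \<Delta> by auto
  define r where "r = gcd (gre \<beta>) (gim \<beta>)"
  have r0: "r \<noteq> 0" using \<beta>0 by (auto simp: r_def gauss_eq_iff)
  have "of_int r dvd \<beta>" by (simp add: of_int_dvd_gauss_iff r_def)
  then obtain y where y: "\<beta> = of_int r * y" ..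
  have parts: "gre \<beta> = r * gre y" "gim \<beta> = r * gim y"
    by (simp_all add: y)
  have "\<bar>r\<bar> * gcd (gre y) (gim y) = gcd (r * gre y) (r * gim y)"
    by (simp add: gcd_mult_distrib_int)
  also have "\<dots> = r"
    unfolding parts[symmetric] r_def[symmetric] by simp
  finally have "\<bar>r\<bar> * gcd (gre y) (gim y) = r" .
  moreover have "\<bar>r\<bar> = r" by (simp add: r_def)
  ultimately have "coprime (gre y) (gim y)" using r0 by (simp add: coprime_iff_gcd_eq_1)
  moreover have "of_int r dvd line_point L n" using n y dvd_mult_left by blast
  then have "r dvd a * d - b * c"
    by (subst det[symmetric]) (auto simp: of_int_dvd_gauss_iff)
  moreover
  obtain w where w: "line_point L n = y * w" using n y by (metis dvd_mult_right dvdE)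
  obtain u v where "u * alpha0 L + v * delta L = 1"
    using primitive_line_bezout[OF L] .
  \<comment> \<open>Coprimality with \<open>delta L\<close> passes from \<open>alpha0 L\<close> to
    every point of the progression, and then to the divisor \<open>y\<close> of the point.\<close>
  then have "u * line_point L n + (v - u * of_int n) * delta L = 1"
    by (simp add: line_point_def algebra_simps)
  then have "(u * w) * y + (v - u * of_int n) * delta L = 1"
    unfolding w by (simp add: ac_simps)
  ultimately show "\<exists>r y u v. \<beta> = of_int r * y \<and> r dvd a * d - b * c \<and> coprime (gre y) (gim y) \<and>
       u * y + v * delta L = 1"
    using y by blast
next
  assume "\<exists>r y u v. \<beta> = of_int r * y \<and> r dvd a * d - b * c \<and> coprime (gre y) (gim y) \<and>
       u * y + v * delta L = 1"
  then obtain r y u v where *: "\<beta> = of_int r * y" "r dvd a * d - b * c" "coprime (gre y) (gim y)"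
       "u * y + v * delta L = 1" by blast
  obtain p q where pq: "p * c + q * d = 1"
    using delta_coprime_parts[OF L(1)] ab by (metis bezout_int coprime_iff_gcd_eq_1 gauss_int.sel)
  \<comment> \<open>Chosen so that point number \<open>n\<close> is \<open>a * d - b * c\<close>
    times \<open>Gauss q (- p)\<close>, hence divisible by \<open>r\<close>.\<close>
  define n where "n = - (p * a + q * b)"
  have "a + c * n = a * (p * c + q * d) + c * n" "b + d * n = b * (p * c + q * d) + d * n"
    unfolding pq by simp_all
  then have "a + c * n = q * (a * d - b * c)" "b + d * n = - p * (a * d - b * c)"
    by (simp_all add: n_def algebra_simps)
  then have "of_int r dvd line_point L n"
    using *(2) by (auto simp: of_int_dvd_gauss_iff line_point_def ab)
  then obtain x where x: "line_point L n = of_int r * x" ..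
  \<comment> \<open>Moving on by multiples of \<open>r\<close> keeps divisibility by
    \<open>r\<close>, while the quotient \<open>x\<close> moves in steps of \<open>delta L\<close>
    and can be made divisible by \<open>y\<close>.\<close>
  obtain m where "y dvd x + delta L * of_int m"
    using primitive_dvd_progression[OF *(3,4)] .
  then have "\<beta> dvd of_int r * (x + delta L * of_int m)"
    unfolding *(1) by (rule mult_dvd_mono[OF dvd_refl])
  also have "\<dots> = line_point L (n + r * m)"
    using x by (simp add: line_point_def algebra_simps)
  finally show "\<beta> \<in> divisor_set L" by (auto simp: divisor_set_def)
qed

theorem theorem11:
  fixes L :: "complex set" and a b c d :: int and \<beta> :: gauss_int
  assumes "gaussian_line L"
    and "primitive_line L"
    and "alpha0 L = Gauss a b"
    and "delta L = Gauss c d"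
    and "a * d - b * c \<noteq> 0"
  shows "\<beta> \<in> divisor_set L \<longleftrightarrow>
    (\<exists>(\<mu> :: gauss_int) (r :: int) (t :: nat) (m :: nat) (\<pi> :: nat \<Rightarrow> gauss_int) (k :: nat \<Rightarrow> nat).
       \<beta> = \<mu> * of_int r * (1 + \<i>\<^sub>G) ^ t * (\<Prod>j\<in>{1..m}. \<pi> j ^ k j) \<and>
       \<mu> \<in> {1, -1, \<i>\<^sub>G, - \<i>\<^sub>G} \<and>
       r dvd a * d - b * c \<and>
       (if (1 + \<i>\<^sub>G) dvd delta L then t = 0 else t \<in> {0, 1}) \<and>
       (\<forall>j\<in>{1..m}. prime_elem (\<pi> j) \<and> non_rational (\<pi> j) \<and>
          \<not> \<pi> j dvd delta L \<and> gnorm (\<pi> j) \<noteq> 2 \<and>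
          (\<forall>n\<in>{1..m}. j \<noteq> n \<longrightarrow> gnorm (\<pi> j) \<noteq> gnorm (\<pi> n))))"
    (is "_ \<longleftrightarrow> ?R")
proof
  assume "\<beta> \<in> divisor_set L"
  then obtain r y u v where *: "\<beta> = of_int r * y" "r dvd a * d - b * c" "coprime (gre y) (gim y)"
      "u * y + v * delta L = 1"
    using divisor_set_iff[OF assms] by blast
  have cop: "w dvd 1" if "w dvd y" "w dvd delta L" for w
    using that by (metis *(4) dvd_add dvd_mult)
  obtain \<mu> t m \<pi> k where f: "y = \<mu> * (1 + \<i>\<^sub>G) ^ t * (\<Prod>j\<in>{1..m}. \<pi> j ^ k j)" "gnorm \<mu> = 1"
      "t \<le> 1" "t = 1 \<longrightarrow> 1 + \<i>\<^sub>G dvd y" "split_primes m \<pi>" "\<forall>j\<in>{1..m}. \<pi> j dvd y"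
    using primitive_factorization[OF *(3)] by blast
  have "\<beta> = \<mu> * of_int r * (1 + \<i>\<^sub>G) ^ t * (\<Prod>j\<in>{1..m}. \<pi> j ^ k j)"
    unfolding *(1) by (subst f(1)) (simp only: ac_simps)
  moreover have "\<mu> \<in> {1, -1, \<i>\<^sub>G, - \<i>\<^sub>G}"
    using f(2) gauss_units by blast
  moreover have "if (1 + \<i>\<^sub>G) dvd delta L then t = 0 else t \<in> {0, 1}"
    using f(3,4) cop one_plus_i_not_unit by (auto simp: le_Suc_eq)
  moreover have "\<not> \<pi> j dvd delta L" if "j \<in> {1..m}" for j
    using cop[of "\<pi> j"] f(5,6) that by (auto simp: split_primes_def prime_elem_def)
  ultimately show ?R
    using *(2) f(5) unfolding split_primes_def by blast
next
  assume ?R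
  then obtain \<mu> r t m \<pi> k where \<beta>: "\<beta> = \<mu> * of_int r * (1 + \<i>\<^sub>G) ^ t * (\<Prod>j\<in>{1..m}. \<pi> j ^ k j)"
    and \<mu>: "\<mu> \<in> {1, -1, \<i>\<^sub>G, - \<i>\<^sub>G}" and r: "r dvd a * d - b * c"
    and t: "if (1 + \<i>\<^sub>G) dvd delta L then t = 0 else t \<in> {0, 1}"
    and \<pi>: "split_primes m \<pi>" and \<pi>\<delta>: "\<And>j. j \<in> {1..m} \<Longrightarrow> \<not> \<pi> j dvd delta L"
    unfolding split_primes_def by blast
  define y where "y = (1 + \<i>\<^sub>G) ^ t * (\<Prod>j\<in>{1..m}. \<pi> j ^ k j)"
  have cy: "coprime (gre y) (gim y)"
    unfolding y_def using \<pi> t by (intro primitive_factored) (auto split: if_splits)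
  \<comment> \<open>Up to associates, the only primes in \<open>y\<close> are the
    \<open>\<pi> j\<close> and, if \<open>t > 0\<close>, also \<open>1 + i\<close>. The conditions
    on them keep each from dividing \<open>delta L\<close>.\<close>
  have pr: "\<not> p dvd delta L" if "prime_elem p" "p dvd y" for p
    using that unfolding y_def
  proof (cases rule: prime_dvd_factored)
    case 1
    then have nd: "\<not> 1 + \<i>\<^sub>G dvd delta L" using t by auto
    have "gnorm p = 2" using prime_not_dvd_one_plus_i that(1) 1 by blast
    then have "1 + \<i>\<^sub>G dvd p" by (rule one_plus_i_dvd_norm_2)
    then show ?thesis using nd dvd_trans by blast
  next
    case (2 j)
    then have "\<pi> j dvd p"
      using prime_elem_dvd_prime_elem[OF that(1)] \<pi> unfolding split_primes_def by blast
    then show ?thesis using \<pi>\<delta> 2 dvd_trans by blast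
  qed
  have "y \<noteq> 0" using cy by auto
  then obtain u v where "u * y + v * delta L = 1"
    using gauss_coprime_bezout pr by blast
  with r cy have "of_int r * y \<in> divisor_set L"
    using divisor_set_iff[OF assms] by blast
  then obtain n where n: "of_int r * y dvd line_point L n" by (auto simp: divisor_set_def)
  \<comment> \<open>The inverse of the unit \<mu>: \<open>of_int r * y\<close> and \<beta> are
    associates, so they divide the same points.\<close>
  obtain \<nu> where "1 = \<mu> * \<nu>"
    using \<mu> gauss_units gauss_unit_iff by (metis dvdE)
  then have "of_int r * y = \<beta> * \<nu>"
    unfolding \<beta> y_def by (metis (no_types, lifting) mult.assoc mult.commute mult.right_neutral)
  with n have "\<beta> dvd line_point L n" by (metis dvd_mult_left)
  then show "\<beta> \<in> divisor_set L" by (auto simp: divisor_set_def)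
qed

end
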